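(* Every regular bounded rational Pythagorean hodograph (PH) curve $\mathbf{R}\colon\mathbb{S}_1\to\mathbb{R}^3$ can be obtained from a homogeneous quaternion polynomial $\mathcal{A}(u,v)\in\mathbb{H}[u,v]$ and a positive bounded rational function $L(u,v)$ on $\mathbb{S}_1$ by setting $$\mathbf{T}(u,v)=\frac{\mathcal{A}(u,v)\,\mathbf{i}\,\mathcal{A}^*(u,v)}{\mathcal{A}(u,v)\,\mathcal{A}^*(u,v)}$$ and using the formula $$\mathbf{R}(u_1,v_1)=\mathbf{R}(u_0,v_0)+\int_{C}L(u,v)\,\mathbf{T}(u,v)\,\mathrm{d}\mathbb{S}_1 ,$$ where $(u_0,v_0)\in\mathbb{S}_1$ is a fixed point, $(u_1,v_1)\in\mathbb{S}_1$ is arbitrary, and $C$ is the oriented circle arc from $(u_0,v_0)$ to $(u_1,v_1)$.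
   Context: The real projective line $\mathbb{P}_1$ is identified with the unit circle $\mathbb{S}_1$ via $(u:v)\leftrightarrow\bigl(\frac{u^2-v^2}{u^2+v^2},\frac{2uv}{u^2+v^2}\bigr)$; points of $\mathbb{S}_1$ are denoted by their coordinates $(u,v)$, and rational functions on $\mathbb{S}_1$ are homogeneous rational functions of degree $0$ in $(u,v)$. The circle is oriented by its unit tangent field $\tau(u,v)=\bigl(\frac{-2uv}{u^2+v^2},\frac{u^2-v^2}{u^2+v^2}\bigr)$, and $\mathrm{d}\mathbb{S}_1$ is the arc length element of the unit circle. $\mathbb{R}^3$ is identified with the purely imaginary quaternions, and $\mathcal{A}^*$ is the quaternion conjugate of $\mathcal{A}$. A regular bounded rational curve is a rational map $\mathbf{R}\colon\mathbb{P}_1\to\mathbb{R}^3$ (equivalently $\mathbb{S}_1\to\mathbb{R}^3$) defined everywhere (all points finite) whose differential vanishes nowhere. Its speed function is $\Vert \mathrm{d}\mathbf{R}(u,v)(\tau(u,v))\Vert$, where $\mathrm{d}\mathbf{R}(u,v)$ is the tangent map at $(u,v)$. It is a regular bounded rational PH curve if its speed function is a rational function. *)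

theory Defs
  imports "HOL-Analysis.Analysis"
begin

section \<open>Quaternions\<close>

datatype quat = Quat (qRe: real) (qI: real) (qJ: real) (qK: real)

lemma quat_eqI:
  "qRe a = qRe b \<Longrightarrow> qI a = qI b \<Longrightarrow> qJ a = qJ b \<Longrightarrow> qK a = qK b \<Longrightarrow> a = b"
  by (cases a, cases b) simp

lemma quat_eq_iff:
  "a = b \<longleftrightarrow> qRe a = qRe b \<and> qI a = qI b \<and> qJ a = qJ b \<and> qK a = qK b"
  by (auto intro: quat_eqI)

instantiation quat :: real_vector
begin

definition "0 = Quat 0 0 0 0"
definition "a + b = Quat (qRe a + qRe b) (qI a + qI b) (qJ a + qJ b) (qK a + qK b)"
definition "- a = Quat (- qRe a) (- qI a) (- qJ a) (- qK a)"
definition "a - b = Quat (qRe a - qRe b) (qI a - qI b) (qJ a - qJ b) (qK a - qK b)"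
definition "r *\<^sub>R a = Quat (r * qRe a) (r * qI a) (r * qJ a) (r * qK a)"

instance
  by standard
    (simp_all add: quat_eq_iff zero_quat_def plus_quat_def uminus_quat_def minus_quat_def
      scaleR_quat_def algebra_simps)

end

instantiation quat :: "{real_algebra_1, division_ring}"
begin

definition "1 = Quat 1 0 0 0"

definition "a * b = Quat
  (qRe a * qRe b - qI a * qI b - qJ a * qJ b - qK a * qK b)
  (qRe a * qI b + qI a * qRe b + qJ a * qK b - qK a * qJ b)
  (qRe a * qJ b - qI a * qK b + qJ a * qRe b + qK a * qI b)
  (qRe a * qK b + qI a * qJ b - qJ a * qI b + qK a * qRe b)"

definition "inverse a = (let s = (qRe a)\<^sup>2 + (qI a)\<^sup>2 + (qJ a)\<^sup>2 + (qK a)\<^sup>2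
  in Quat (qRe a / s) (- qI a / s) (- qJ a / s) (- qK a / s))"

definition "a div b = a * inverse b" for a b :: quat

instance
proof
  fix a b c :: quat and r :: real
  show "a * b * c = a * (b * c)" "1 * a = a" "a * 1 = a"
    "(a + b) * c = a * c + b * c" "a * (b + c) = a * b + a * c"
    "(0::quat) \<noteq> 1" "r *\<^sub>R a * b = r *\<^sub>R (a * b)" "a * r *\<^sub>R b = r *\<^sub>R (a * b)"
    "inverse (0::quat) = 0"
    by (simp_all add: quat_eq_iff zero_quat_def plus_quat_def scaleR_quat_def one_quat_def
        times_quat_def inverse_quat_def algebra_simps)
  show "a div b = a * inverse b"
    by (rule divide_quat_def)
  assume "a \<noteq> 0"
  define s where "s = (qRe a)\<^sup>2 + (qI a)\<^sup>2 + (qJ a)\<^sup>2 + (qK a)\<^sup>2"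
  have "s \<noteq> 0"
    using \<open>a \<noteq> 0\<close> unfolding s_def
    by (auto simp: quat_eq_iff zero_quat_def add_nonneg_eq_0_iff)
  moreover have "inverse a = Quat (qRe a / s) (- qI a / s) (- qJ a / s) (- qK a / s)"
    by (simp add: inverse_quat_def s_def Let_def)
  moreover have "qRe a * qRe a + qI a * qI a + qJ a * qJ a + qK a * qK a = s"
    by (simp add: s_def power2_eq_square)
  ultimately show "inverse a * a = 1" "a * inverse a = 1"
    by (simp_all add: quat_eq_iff times_quat_def one_quat_def mult.commute
        flip: add_divide_distrib diff_divide_distrib)
qed

end

definition qcnj :: "quat \<Rightarrow> quat" where
  "qcnj a = Quat (qRe a) (- qI a) (- qJ a) (- qK a)"

definition quat_i :: quat where
  "quat_i = Quat 0 1 0 0"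

text \<open>The identification of \<open>\<real>\<^sup>3\<close> with the purely imaginary quaternions.\<close>

definition quat_of_vec :: "real^3 \<Rightarrow> quat" where
  "quat_of_vec x = Quat 0 (x $ 1) (x $ 2) (x $ 3)"


section \<open>The circle and the projective line\<close>

abbreviation unit_circle :: "complex set" where
  "unit_circle \<equiv> sphere 0 1"

text \<open>The plane containing the circle is \<open>complex\<close>. A point with homogeneous
  coordinates \<open>(u : v)\<close> is \<open>(u + iv)\<^sup>2 / \<bar>u + iv\<bar>\<^sup>2\<close>; the coordinates are only meaningful for
  \<open>(u, v) \<noteq> (0, 0)\<close>.\<close>

definition to_circle :: "real \<Rightarrow> real \<Rightarrow> complex" where
  "to_circle u v = Complex ((u\<^sup>2 - v\<^sup>2) / (u\<^sup>2 + v\<^sup>2)) (2 * u * v / (u\<^sup>2 + v\<^sup>2))"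

definition circle_tangent :: "complex \<Rightarrow> complex" where
  "circle_tangent p = Complex (- Im p) (Re p)"

lemma circle_tangent_to_circle:
  "circle_tangent (to_circle u v) =
    Complex (- 2 * u * v / (u\<^sup>2 + v\<^sup>2)) ((u\<^sup>2 - v\<^sup>2) / (u\<^sup>2 + v\<^sup>2))"
  by (simp add: circle_tangent_def to_circle_def)

lemma to_circle_image: "(\<lambda>(u, v). to_circle u v) ` (- {(0, 0)}) = unit_circle"
proof (intro equalityI subsetI)
  fix p assume "p \<in> (\<lambda>(u, v). to_circle u v) ` (- {(0, 0)})"
  then obtain u v where uv: "(u, v) \<noteq> (0, 0)" and p: "p = to_circle u v" by auto
  have "u\<^sup>2 + v\<^sup>2 \<noteq> 0" using uv by (auto simp: add_nonneg_eq_0_iff)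
  moreover have "(u\<^sup>2 - v\<^sup>2)\<^sup>2 + (2 * u * v)\<^sup>2 = (u\<^sup>2 + v\<^sup>2)\<^sup>2" by algebra
  ultimately have "((u\<^sup>2 - v\<^sup>2) / (u\<^sup>2 + v\<^sup>2))\<^sup>2 + (2 * u * v / (u\<^sup>2 + v\<^sup>2))\<^sup>2 = 1"
    by (simp add: power_divide flip: add_divide_distrib)
  then show "p \<in> unit_circle" by (simp add: p to_circle_def cmod_def)
next
  fix p :: complex assume p: "p \<in> unit_circle"
  define t where "t = Arg2pi p / 2"
  have "p = cis (2 * t)"
    using p complex_norm_eq_1_exp[of p] by (simp add: t_def cis_conv_exp)
  moreover have "to_circle (cos t) (sin t) = cis (2 * t)"
    by (simp add: to_circle_def complex_eq_iff cos_double sin_double)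
  moreover have "(cos t, sin t) \<noteq> (0, 0)"
    using sin_zero_abs_cos_one[of t] by auto
  ultimately show "p \<in> (\<lambda>(u, v). to_circle u v) ` (- {(0, 0)})"
    by (intro image_eqI[where x = "(cos t, sin t)"]) simp_all
qed

text \<open>The tangent map at \<open>p\<close> of a function on the circle. A derivative within the circle is
  determined only on the tangent line \<open>{w. w \<bullet> p = 0}\<close>, so only its values there are meaningful
  (lemma \<open>circle_deriv_unique\<close>).\<close>

definition circle_deriv ::
    "(complex \<Rightarrow> 'a::real_normed_vector) \<Rightarrow> complex \<Rightarrow> complex \<Rightarrow> 'a" where
  "circle_deriv f p = frechet_derivative f (at p within unit_circle)"

lemma circle_deriv_unique:
  assumes p: "p \<in> unit_circle" and w: "w \<bullet> p = 0"
    and D: "(f has_derivative D) (at p within unit_circle)"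
  shows "circle_deriv f p w = D w"
proof -
  define g where "g s = p * cis s" for s
  have g: "(g has_derivative (\<lambda>h. h *\<^sub>R (\<i> * p))) (at 0)"
    unfolding g_def by (auto intro!: derivative_eq_intros simp: scaleR_conv_of_real)
  have g0: "g 0 = p" and gU: "range g \<subseteq> unit_circle"
    using p by (auto simp: g_def norm_mult)
  have chain: "((f \<circ> g) has_derivative (\<lambda>h. E (h *\<^sub>R (\<i> * p)))) (at 0)"
    if "(f has_derivative E) (at p within unit_circle)" for E
    using diff_chain_within[OF g has_derivative_subset[of f E "g 0" unit_circle "range g"]]
      that gU by (simp add: g0 o_def)
  have F: "(f has_derivative circle_deriv f p) (at p within unit_circle)"
    using D unfolding circle_deriv_def
    by (metis differentiableI frechet_derivative_works)
  have eq: "circle_deriv f p (h *\<^sub>R (\<i> * p)) = D (h *\<^sub>R (\<i> * p))" for h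
    using fun_cong[OF has_derivative_unique[OF chain[OF F] chain[OF D]], of h] .
  define x y a b where "x = Re p" and "y = Im p" and "a = Re w" and "b = Im w"
  have n: "x * x + y * y = 1" and o: "a * x + b * y = 0"
    using p w by (simp_all add: x_def y_def a_def b_def cmod_def inner_complex_def power2_eq_square)
  have "a = a * (x * x + y * y) - x * (a * x + b * y)"
    "b = b * (x * x + y * y) - y * (a * x + b * y)"
    by (simp_all add: n o)
  then have "a = (b * x - a * y) * (- y)" "b = (b * x - a * y) * x"
    by (simp_all add: algebra_simps)
  then have "w = (b * x - a * y) *\<^sub>R (\<i> * p)"
    by (simp add: complex_eq_iff x_def y_def a_def b_def)
  then show ?thesis using eq[of "b * x - a * y"] by simp
qed

text \<open>The integral with respect to arc length over the counterclockwise arc from \<open>p\<close> to \<open>q\<close>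
  (the single point \<open>p\<close> if \<open>p = q\<close>), by the parametrisation \<open>s \<mapsto> p * cis s\<close>.\<close>

definition arc_integral :: "complex \<Rightarrow> complex \<Rightarrow> (complex \<Rightarrow> 'a::banach) \<Rightarrow> 'a" where
  "arc_integral p q f = integral {0..Arg2pi (q / p)} (\<lambda>s. f (p * cis s))"


section \<open>Rational functions on the circle\<close>

text \<open>Homogeneous polynomials of degree \<open>n\<close> in two real variables, with coefficients in a real
  vector space, are represented by their polynomial functions.\<close>

definition hom_poly :: "nat \<Rightarrow> (real \<Rightarrow> real \<Rightarrow> 'a::real_vector) \<Rightarrow> bool" where
  "hom_poly n P \<longleftrightarrow> (\<exists>a. \<forall>u v. P u v = (\<Sum>k\<le>n. (u ^ k * v ^ (n - k)) *\<^sub>R a k))"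

definition rational_on_circle :: "(complex \<Rightarrow> 'a::real_vector) \<Rightarrow> bool" where
  "rational_on_circle f \<longleftrightarrow>
    (\<exists>n P Q. hom_poly n P \<and> hom_poly n Q \<and> (\<exists>u v. Q u v \<noteq> (0::real)) \<and>
      (\<forall>u v. (u, v) \<noteq> (0, 0) \<longrightarrow> Q u v \<noteq> 0 \<longrightarrow> f (to_circle u v) = P u v /\<^sub>R Q u v))"

text \<open>Bounded rational functions: no poles on the circle.\<close>

definition bounded_rational_on_circle :: "(complex \<Rightarrow> 'a::real_vector) \<Rightarrow> bool" where
  "bounded_rational_on_circle f \<longleftrightarrow>
    (\<exists>n P Q. hom_poly n P \<and> hom_poly n Q \<and>
      (\<forall>u v. (u, v) \<noteq> (0, 0) \<longrightarrow> Q u v \<noteq> (0::real) \<and> f (to_circle u v) = P u v /\<^sub>R Q u v))"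


section \<open>Regular bounded rational PH curves\<close>

definition regular_bounded_rational_curve :: "(complex \<Rightarrow> real^3) \<Rightarrow> bool" where
  "regular_bounded_rational_curve R \<longleftrightarrow> bounded_rational_on_circle R \<and>
    (\<forall>p\<in>unit_circle. \<exists>w. w \<bullet> p = 0 \<and> circle_deriv R p w \<noteq> 0)"

definition circle_speed :: "(complex \<Rightarrow> real^3) \<Rightarrow> complex \<Rightarrow> real" where
  "circle_speed R p = norm (circle_deriv R p (circle_tangent p))"

definition regular_bounded_rational_PH_curve :: "(complex \<Rightarrow> real^3) \<Rightarrow> bool" where
  "regular_bounded_rational_PH_curve R \<longleftrightarrow>
    regular_bounded_rational_curve R \<and> rational_on_circle (circle_speed R)"

end

theory Submission
  imports Defs
begin

text \<open>
  The function \<open>L\<close> is the speed of the curve and \<open>T\<close> its unit tangent vector field, so the integral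
  formula is the fundamental theorem of calculus along the arc (\<open>arc_integral_velocity\<close>). What
  has to be shown is that \<open>L\<close> has no poles and that \<open>T\<close> is the image of \<open>\<i>\<close> under conjugation by a
  quaternion polynomial without real zeros.

  The velocity is a bounded rational function, because differentiating along rotations maps
  homogeneous polynomials to homogeneous polynomials of the same degree
  (\<open>bounded_rational_velocity\<close>). Hence the speed, its norm, is continuous, and it is rational by
  hypothesis. A continuous rational function has no poles: once the common real zeros of numerator
  and denominator are cancelled, a zero of the denominator would be one of the numerator as
  well (\<open>continuous_rational_imp_bounded_rational\<close>). By regularity the speed has no zeros, so \<open>T\<close> is a
  bounded rational field of unit vectors.

  The vector \<open>T + \<i>\<close> bisects the angle between \<open>\<i>\<close> and \<open>T\<close>, so the half turn about it takes \<open>\<i>\<close> to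
  \<open>T\<close>: the quaternion \<open>A = T + \<i>\<close> satisfies \<open>A * \<i> = T * A\<close>. Multiplied by the denominator of
  \<open>T\<close> it is a quaternion polynomial, which vanishes where \<open>T = - \<i>\<close>. The equation is linear in
  \<open>A\<close>, so the real zeros can be cancelled as linear factors unless \<open>T\<close> is constantly \<open>- \<i>\<close>, and
  then \<open>A = \<j>\<close> will do
  (\<open>unit_field_quaternion_polynomial\<close>).

  Both arguments rest on \<open>hom_poly_remove_zeros\<close>: a nonzero homogeneous polynomial with values in
  a real vector space is a real polynomial times one that has no real zeros. It is applied to the pair
  of numerator and denominator, and to the quaternion polynomial. After each cancellation an identity
  is known only off the zeros of some nonzero polynomial; it extends to these by continuity
  (\<open>continuous_eq_0_off_hom_poly_zeros\<close>).
\<close>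

section \<open>Homogeneous polynomials\<close>

lemma hom_poly_const: "hom_poly 0 (\<lambda>u v. c)"
  unfolding hom_poly_def by (rule exI[of _ "\<lambda>_. c"]) simp

lemma hom_poly_0_const:
  assumes "hom_poly 0 P"
  obtains c where "P = (\<lambda>u v. c)"
  using assms unfolding hom_poly_def fun_eq_iff by auto

lemma hom_poly_monom: "hom_poly n (\<lambda>u v. v ^ n *\<^sub>R c)"
  unfolding hom_poly_def
  by (rule exI[of _ "\<lambda>k. if k = 0 then c else 0"]) (simp add: if_distrib cong: if_cong)

lemma hom_poly_add:
  assumes "hom_poly n P" "hom_poly n Q"
  shows "hom_poly n (\<lambda>u v. P u v + Q u v)"
proof -
  obtain a b where "\<And>u v. P u v = (\<Sum>k\<le>n. (u ^ k * v ^ (n - k)) *\<^sub>R a k)"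
    "\<And>u v. Q u v = (\<Sum>k\<le>n. (u ^ k * v ^ (n - k)) *\<^sub>R b k)"
    using assms unfolding hom_poly_def by blast
  then show ?thesis
    unfolding hom_poly_def
    by (intro exI[of _ "\<lambda>k. a k + b k"]) (simp add: scaleR_add_right sum.distrib)
qed

lemma hom_poly_linear:
  assumes "linear h" "hom_poly n P"
  shows "hom_poly n (\<lambda>u v. h (P u v))"
proof -
  obtain a where "\<And>u v. P u v = (\<Sum>k\<le>n. (u ^ k * v ^ (n - k)) *\<^sub>R a k)"
    using assms(2) unfolding hom_poly_def by blast
  then show ?thesis
    unfolding hom_poly_def
    by (intro exI[of _ "\<lambda>k. h (a k)"]) (simp add: linear_sum[OF assms(1)] linear_scale[OF assms(1)])
qed

lemma hom_poly_cmult: "hom_poly n P \<Longrightarrow> hom_poly n (\<lambda>u v. c *\<^sub>R P u v)"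
  by (rule hom_poly_linear) (simp_all add: linear_iff scaleR_add_right)

lemma hom_poly_diff:
  assumes "hom_poly n P" "hom_poly n Q"
  shows "hom_poly n (\<lambda>u v. P u v - Q u v)"
  using hom_poly_add[OF assms(1) hom_poly_cmult[OF assms(2), of "- 1"]] by simp

lemma hom_poly_Pair:
  assumes "hom_poly n P" "hom_poly n Q"
  shows "hom_poly n (\<lambda>u v. (P u v, Q u v))"
proof -
  have "hom_poly n (\<lambda>u v. (P u v, 0) + (0, Q u v))"
    by (intro hom_poly_add hom_poly_linear[OF _ assms(1)] hom_poly_linear[OF _ assms(2)])
      (simp_all add: linear_iff)
  then show ?thesis by simp
qed

lemma hom_poly_times_u:
  assumes "hom_poly n P"
  shows "hom_poly (Suc n) (\<lambda>u v. u *\<^sub>R P u v)"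
proof -
  obtain a where "\<And>u v. P u v = (\<Sum>k\<le>n. (u ^ k * v ^ (n - k)) *\<^sub>R a k)"
    using assms unfolding hom_poly_def by blast
  then show ?thesis
    unfolding hom_poly_def
    by (intro exI[of _ "\<lambda>k. case k of 0 \<Rightarrow> 0 | Suc j \<Rightarrow> a j"])
      (simp add: sum.atMost_Suc_shift scaleR_sum_right mult.assoc del: sum.atMost_Suc)
qed

lemma hom_poly_times_v:
  assumes "hom_poly n P"
  shows "hom_poly (Suc n) (\<lambda>u v. v *\<^sub>R P u v)"
proof -
  obtain a where "\<And>u v. P u v = (\<Sum>k\<le>n. (u ^ k * v ^ (n - k)) *\<^sub>R a k)"
    using assms unfolding hom_poly_def by blast
  then show ?thesis
    unfolding hom_poly_def
    by (intro exI[of _ "\<lambda>k. if k \<le> n then a k else 0"])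
      (auto simp: scaleR_sum_right Suc_diff_le mult.left_commute intro!: sum.cong)
qed

text \<open>Splitting off the pure power of \<open>v\<close> leaves \<open>u\<close> times a polynomial of lower degree, so
  properties of homogeneous polynomials can be proved by induction on the degree, without
  sums of monomials.\<close>

lemma hom_poly_induct [consumes 1, case_names const step]:
  assumes "hom_poly n P"
    and const: "\<And>c. \<Phi> 0 (\<lambda>u v. c)"
    and step: "\<And>n P c. hom_poly n P \<Longrightarrow> \<Phi> n P \<Longrightarrow>
      \<Phi> (Suc n) (\<lambda>u v. u *\<^sub>R P u v + v ^ Suc n *\<^sub>R c)"
  shows "\<Phi> n P"
  using assms(1)
proof (induction n arbitrary: P)
  case 0
  then obtain c where "P = (\<lambda>u v. c)" by (rule hom_poly_0_const)
  then show ?case using const by simp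
next
  case (Suc n)
  then obtain a where a: "\<And>u v. P u v = (\<Sum>k\<le>Suc n. (u ^ k * v ^ (Suc n - k)) *\<^sub>R a k)"
    unfolding hom_poly_def by blast
  define P1 where "P1 u v = (\<Sum>k\<le>n. (u ^ k * v ^ (n - k)) *\<^sub>R a (Suc k))" for u v
  have P: "P = (\<lambda>u v. u *\<^sub>R P1 u v + v ^ Suc n *\<^sub>R a 0)"
    unfolding a sum.atMost_Suc_shift P1_def
    by (intro ext) (simp add: scaleR_sum_right mult.assoc)
  have "hom_poly n P1"
    unfolding hom_poly_def P1_def by (intro exI[of _ "\<lambda>k. a (Suc k)"]) simp
  then show ?case unfolding P by (intro step Suc.IH)
qed

lemma hom_poly_mult:
  assumes "hom_poly m f" "hom_poly n P"
  shows "hom_poly (m + n) (\<lambda>u v. f u v *\<^sub>R P u v)"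
  using assms(1)
proof (induction rule: hom_poly_induct)
  case (const c)
  then show ?case using hom_poly_cmult[OF assms(2)] by simp
next
  case (step m f c)
  have pow: "hom_poly (k + n) (\<lambda>u v. v ^ k *\<^sub>R P u v)" for k
  proof (induction k)
    case (Suc k)
    then show ?case using hom_poly_times_v[OF Suc] by simp
  qed (simp add: assms(2))
  have "hom_poly (Suc (m + n)) (\<lambda>u v. u *\<^sub>R (f u v *\<^sub>R P u v) + c *\<^sub>R (v ^ Suc m *\<^sub>R P u v))"
    using pow[of "Suc m"] by (intro hom_poly_add hom_poly_times_u step hom_poly_cmult) simp
  then show ?case by (simp add: algebra_simps)
qed

lemma hom_poly_differentiable:
  fixes P :: "real \<Rightarrow> real \<Rightarrow> 'a::real_normed_vector" and a b :: "'b::real_normed_vector \<Rightarrow> real"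
  assumes "hom_poly n P" "a differentiable (at x)" "b differentiable (at x)"
  shows "(\<lambda>z. P (a z) (b z)) differentiable (at x)"
  using assms(1)
  by (induction rule: hom_poly_induct)
    (intro differentiable_const differentiable_add differentiable_scaleR differentiable_power
      assms | assumption)+

lemma hom_poly_continuous_on:
  fixes P :: "real \<Rightarrow> real \<Rightarrow> 'a::real_normed_vector"
  assumes "hom_poly n P" "continuous_on S a" "continuous_on S b"
  shows "continuous_on S (\<lambda>z. P (a z) (b z))"
  using assms(1) by (induction rule: hom_poly_induct) (intro continuous_intros assms | assumption)+

lemma hom_poly_on_line:
  fixes Q :: "real \<Rightarrow> real \<Rightarrow> real"
  assumes "hom_poly n Q"
  shows "\<exists>p. \<forall>t. Q (a + t * b) (c + t * d) = poly p t"
  using assms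
proof (induction rule: hom_poly_induct)
  case (const r)
  show ?case by (rule exI[of _ "[:r:]"]) simp
next
  case (step n Q r)
  then obtain p where p: "\<And>t. Q (a + t * b) (c + t * d) = poly p t" by blast
  show ?case
    unfolding p by (intro exI[of _ "[:a, b:] * p + [:c, d:] ^ Suc n * [:r:]"])
      (simp add: algebra_simps)
qed

text \<open>A line that joins a given point to a point with \<open>Q \<noteq> 0\<close> contains only finitely many
  zeros of \<open>Q\<close>. Hence the zero set of \<open>Q\<close> is nowhere dense, and a continuous identity that
  holds off this set holds everywhere.\<close>

lemma continuous_eq_0_off_hom_poly_zeros:
  fixes Q :: "real \<Rightarrow> real \<Rightarrow> real" and g :: "real \<Rightarrow> real \<Rightarrow> 'a::real_normed_vector"
  assumes Q: "hom_poly n Q" "Q a b \<noteq> 0"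
    and cont: "continuous_on (- {(0, 0)}) (\<lambda>(u, v). g u v)"
    and zero: "\<And>u v. (u, v) \<noteq> (0, 0) \<Longrightarrow> Q u v \<noteq> 0 \<Longrightarrow> g u v = 0"
    and uv: "(u, v) \<noteq> (0, 0)"
  shows "g u v = 0"
proof -
  define w where "w t = (u + t * (a - u), v + t * (b - v))" for t
  obtain p where p: "\<And>t. Q (u + t * (a - u)) (v + t * (b - v)) = poly p t"
    using hom_poly_on_line[OF Q(1)] by blast
  have "poly p 1 \<noteq> 0" using p[of 1] Q(2) by simp
  then have "finite {t. poly p t = 0}" by (intro poly_roots_finite) auto
  then have "\<forall>\<^sub>F t in at 0. t \<notin> {t. poly p t = 0}"
    using islimpt_finite islimpt_iff_eventually by blast
  then have ev1: "\<forall>\<^sub>F t in at 0. Q (u + t * (a - u)) (v + t * (b - v)) \<noteq> 0"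
    by (simp add: p)
  have "isCont w 0" unfolding w_def by (intro continuous_intros)
  then have w: "(w \<longlongrightarrow> (u, v)) (at 0)" by (simp add: isCont_def w_def)
  then have ev2: "\<forall>\<^sub>F t in at 0. w t \<noteq> (0, 0)"
    using uv by (rule tendsto_imp_eventually_ne)
  have "isCont (\<lambda>(u, v). g u v) (u, v)"
    using continuous_on_interior[OF cont, of "(u, v)"] uv by (simp add: interior_open open_Compl)
  then have lim: "((\<lambda>t. case w t of (u, v) \<Rightarrow> g u v) \<longlongrightarrow> g u v) (at 0)"
    using isCont_tendsto_compose[OF _ w] by fastforce
  have "\<forall>\<^sub>F t in at 0. (case w t of (u, v) \<Rightarrow> g u v) = 0"
    using ev1 ev2 by eventually_elim (auto simp: w_def intro!: zero)
  then have "((\<lambda>t. case w t of (u, v) \<Rightarrow> g u v) \<longlongrightarrow> 0) (at 0)"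
    by (rule tendsto_eventually)
  then show ?thesis using lim by (intro tendsto_unique) auto
qed


section \<open>Removing real zeros\<close>

lemma hom_poly_swap:
  assumes "hom_poly n P"
  shows "hom_poly n (\<lambda>u v. P v u)"
proof -
  obtain a where a: "\<And>u v. P u v = (\<Sum>k\<le>n. (u ^ k * v ^ (n - k)) *\<^sub>R a k)"
    using assms unfolding hom_poly_def by blast
  have "P v u = (\<Sum>k\<le>n. (u ^ k * v ^ (n - k)) *\<^sub>R a (n - k))" for u v
    unfolding a
    by (rule sum.reindex_bij_witness[of _ "\<lambda>k. n - k" "\<lambda>k. n - k"]) (auto simp: mult.commute)
  then show ?thesis
    unfolding hom_poly_def by (intro exI[of _ "\<lambda>k. a (n - k)"] allI)
qed

text \<open>Since \<open>c * u = (c * u - b * v) + b * v\<close>, multiplying the remainder \<open>v ^ m *\<^sub>R r\<close> by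
  \<open>u\<close> gives a multiple of the linear form and a remainder that is again a pure power of
  \<open>v\<close>. This remainder is the value at the zero \<open>(b, c)\<close> of the form, up to a
  nonzero factor.\<close>

lemma hom_poly_division:
  assumes "hom_poly (Suc n) P" "c \<noteq> 0"
  shows "\<exists>P1 r. hom_poly n P1 \<and> (\<forall>u v. P u v = (c * u - b * v) *\<^sub>R P1 u v + v ^ Suc n *\<^sub>R r)"
  using assms(1)
proof (induction "Suc n" P arbitrary: n rule: hom_poly_induct)
  case (step n P d)
  show ?case
  proof (cases n)
    case 0
    then obtain e where e: "P = (\<lambda>u v. e)" using step(1) by (blast elim: hom_poly_0_const)
    have "u *\<^sub>R e + v *\<^sub>R d = (c * u - b * v) *\<^sub>R (1 / c) *\<^sub>R e + v *\<^sub>R ((b / c) *\<^sub>R e + d)" for u v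
    proof -
      have "u *\<^sub>R e = ((c * u - b * v) / c + b * v / c) *\<^sub>R e"
        using assms(2) by (simp add: diff_divide_distrib)
      then show ?thesis
        by (simp add: scaleR_add_left scaleR_add_right mult.commute)
    qed
    then show ?thesis
      unfolding e 0 using hom_poly_const[of "(1 / c) *\<^sub>R e"] by auto
  next
    case (Suc m)
    then obtain P1 r where P1: "hom_poly m P1"
      and P: "\<And>u v. P u v = (c * u - b * v) *\<^sub>R P1 u v + v ^ Suc m *\<^sub>R r"
      using step(2) by blast
    have *: "u *\<^sub>R P u v + v ^ Suc n *\<^sub>R d
        = (c * u - b * v) *\<^sub>R (u *\<^sub>R P1 u v + v ^ n *\<^sub>R (1 / c) *\<^sub>R r)
          + v ^ Suc n *\<^sub>R ((b / c) *\<^sub>R r + d)" for u v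
    proof -
      have "u * v ^ n = (c * u - b * v) * (v ^ n * (1 / c)) + v ^ Suc n * (b / c)"
        using assms(2) by (simp add: field_simps)
      then have "(u * v ^ n) *\<^sub>R r
        = (c * u - b * v) *\<^sub>R v ^ n *\<^sub>R (1 / c) *\<^sub>R r + v ^ Suc n *\<^sub>R (b / c) *\<^sub>R r"
        by (metis scaleR_add_left scaleR_scaleR)
      then show ?thesis
        by (simp add: P Suc scaleR_add_right mult.left_commute mult.commute)
    qed
    have "hom_poly n (\<lambda>u v. u *\<^sub>R P1 u v + v ^ n *\<^sub>R (1 / c) *\<^sub>R r)"
      using hom_poly_times_u[OF P1] Suc by (intro hom_poly_add hom_poly_monom) simp
    then show ?thesis using * by blast
  qed
qed

lemma hom_poly_divide_zero:
  assumes P: "hom_poly (Suc n) P" and z: "P a b = 0" "(a, b) \<noteq> (0, 0)"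
  shows "\<exists>P1. hom_poly n P1 \<and> (\<forall>u v. P u v = (b * u - a * v) *\<^sub>R P1 u v)"
proof -
  \<comment> \<open>The case \<open>b \<noteq> 0\<close>; if \<open>b = 0\<close>, then \<open>a \<noteq> 0\<close>, and the variables can be exchanged.\<close>
  have main: "\<exists>P1. hom_poly n P1 \<and> (\<forall>u v. P u v = (b * u - a * v) *\<^sub>R P1 u v)"
    if P: "hom_poly (Suc n) P" and z: "P a b = 0" "b \<noteq> 0" for P :: "real \<Rightarrow> real \<Rightarrow> 'a" and a b
  proof -
    obtain P1 r where P1: "hom_poly n P1"
      and eq: "\<And>u v. P u v = (b * u - a * v) *\<^sub>R P1 u v + v ^ Suc n *\<^sub>R r"
      using hom_poly_division[OF P \<open>b \<noteq> 0\<close>] by blast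
    have "r = 0" using eq[of a b] z by (simp add: mult.commute)
    then show ?thesis using P1 eq by auto
  qed
  show ?thesis
  proof (cases "b = 0")
    case True
    then have "a \<noteq> 0" using z by simp
    then obtain P1 where P1: "hom_poly n P1" "\<And>u v. P v u = (a * u - b * v) *\<^sub>R P1 u v"
      using main[OF hom_poly_swap[OF P], where a = b and b = a] z(1) by blast
    have "hom_poly n (\<lambda>u v. - 1 *\<^sub>R P1 v u)"
      by (rule hom_poly_cmult[OF hom_poly_swap[OF P1(1)]])
    moreover have "P u v = (b * u - a * v) *\<^sub>R (- 1 *\<^sub>R P1 v u)" for u v
    proof -
      have "(b * u - a * v) * - 1 = a * v - b * u" by simp
      then show ?thesis by (simp only: P1(2)[of u v] scaleR_scaleR)
    qed
    ultimately show ?thesis by blast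
  next
    case False
    then show ?thesis using main[OF P z(1)] by blast
  qed
qed

text \<open>Each real zero splits off a linear form, and the degree bounds the number of
  such steps. The factor \<open>g\<close> collects the real linear forms that are common to all
  components of \<open>P\<close>, so no factorisation of single components is needed.\<close>

lemma hom_poly_remove_zeros:
  assumes "hom_poly n P" "P a b \<noteq> 0"
  shows "\<exists>d m g P1. hom_poly d g \<and> hom_poly m P1 \<and> (\<forall>u v. P u v = (g u v :: real) *\<^sub>R P1 u v) \<and>
    (\<forall>u v. (u, v) \<noteq> (0, 0) \<longrightarrow> P1 u v \<noteq> 0)"
  using assms
proof (induction n arbitrary: P)
  case 0
  then have "hom_poly 0 (\<lambda>u v. 1::real)" "P u v \<noteq> 0" for u v
    by (auto simp: hom_poly_def hom_poly_const)
  then show ?case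
    using 0(1) by (intro exI[of _ 0] exI[of _ "\<lambda>u v. 1"] exI[of _ P]) simp
next
  case (Suc n)
  show ?case
  proof (cases "\<exists>c d. (c, d) \<noteq> (0, 0) \<and> P c d = 0")
    case True
    then obtain c d where "(c, d) \<noteq> (0, 0)" "P c d = 0" by blast
    then obtain P1 where P1: "hom_poly n P1" "\<And>u v. P u v = (d * u - c * v) *\<^sub>R P1 u v"
      using hom_poly_divide_zero[OF Suc.prems(1)] by blast
    have "P1 a b \<noteq> 0" using Suc.prems(2) P1(2) by auto
    then obtain k m g P2 where g: "hom_poly k g" and P2: "hom_poly m P2"
      and eq: "\<And>u v. P1 u v = (g u v :: real) *\<^sub>R P2 u v"
      and nz: "\<And>u v. (u, v) \<noteq> (0, 0) \<Longrightarrow> P2 u v \<noteq> 0"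
      using Suc.IH[OF P1(1)] by blast
    have "hom_poly (Suc k) (\<lambda>u v. d *\<^sub>R (u *\<^sub>R g u v) - c *\<^sub>R (v *\<^sub>R g u v))"
      by (intro hom_poly_diff hom_poly_cmult hom_poly_times_u hom_poly_times_v g)
    moreover have "P u v = (d *\<^sub>R (u *\<^sub>R g u v) - c *\<^sub>R (v *\<^sub>R g u v)) *\<^sub>R P2 u v" for u v
      by (simp add: P1(2) eq algebra_simps)
    ultimately show ?thesis using P2 nz by blast
  next
    case False
    then show ?thesis
      using Suc.prems(1) hom_poly_const[of "1::real"]
      by (intro exI[of _ 0] exI[of _ "Suc n"] exI[of _ "\<lambda>u v. 1"] exI[of _ P]) auto
  qed
qed


section \<open>Rational functions on the circle\<close>

lemma to_circle_in: "(u, v) \<noteq> (0, 0) \<Longrightarrow> to_circle u v \<in> unit_circle"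
  unfolding to_circle_image[symmetric] by auto

lemma continuous_on_to_circle:
  "continuous_on (- {(0, 0)}) (\<lambda>z. to_circle (fst z) (snd z))"
  unfolding to_circle_def Complex_eq
  by (intro continuous_intros) (auto simp: add_nonneg_eq_0_iff)

lemma continuous_on_comp_to_circle:
  assumes "continuous_on unit_circle f"
  shows "continuous_on (- {(0, 0)}) (\<lambda>z. f (to_circle (fst z) (snd z)))"
  using continuous_on_compose2[OF assms continuous_on_to_circle] to_circle_image
  by (simp add: case_prod_unfold)

text \<open>Rotating \<open>(u, v)\<close> by the angle \<open>s\<close> moves its image on the circle by \<open>2 * s\<close>.\<close>

lemma to_circle_rotate:
  "to_circle (u * cos s - v * sin s) (v * cos s + u * sin s) = to_circle u v * cis (2 * s)"
proof -
  have "(u * cos s - v * sin s)\<^sup>2 + (v * cos s + u * sin s)\<^sup>2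
      = (u\<^sup>2 + v\<^sup>2) * ((cos s)\<^sup>2 + (sin s)\<^sup>2)"
    by algebra
  then have 2: "(u * cos s - v * sin s)\<^sup>2 + (v * cos s + u * sin s)\<^sup>2 = u\<^sup>2 + v\<^sup>2"
    by simp
  have 3: "(u * cos s - v * sin s)\<^sup>2 - (v * cos s + u * sin s)\<^sup>2
      = (u\<^sup>2 - v\<^sup>2) * cos (2 * s) - 2 * u * v * sin (2 * s)"
    unfolding cos_double sin_double by algebra
  have 4: "2 * (u * cos s - v * sin s) * (v * cos s + u * sin s)
      = (u\<^sup>2 - v\<^sup>2) * sin (2 * s) + 2 * u * v * cos (2 * s)"
    unfolding cos_double sin_double by algebra
  show ?thesis
    unfolding to_circle_def 2 3 4
    by (simp add: complex_eq_iff add_divide_distrib diff_divide_distrib left_diff_distrib)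
qed

text \<open>Away from \<open>- 1\<close>, and away from \<open>1\<close>, homogeneous coordinates of \<open>p\<close> can be chosen to be affine
  functions of \<open>p\<close>. In them the rational expression extends the function to a neighbourhood of \<open>p\<close>
  in the plane.\<close>

lemma bounded_rational_differentiable:
  fixes f :: "complex \<Rightarrow> 'a::real_normed_vector"
  assumes "bounded_rational_on_circle f" "p \<in> unit_circle"
  shows "f differentiable (at p within unit_circle)"
proof -
  obtain n P Q where P: "hom_poly n P" and Q: "hom_poly n Q"
    and PQ: "\<And>u v. (u, v) \<noteq> (0, 0) \<Longrightarrow> Q u v \<noteq> (0::real) \<and> f (to_circle u v) = P u v /\<^sub>R Q u v"
    using assms(1) unfolding bounded_rational_on_circle_def by blast
  have main: "f differentiable (at p within unit_circle)"
    if a: "a differentiable (at p)" and b: "b differentiable (at p)"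
      and c: "continuous (at p) c" "c p \<noteq> (0::real)"
      and ab: "\<And>z. z \<in> unit_circle \<Longrightarrow> c z \<noteq> 0 \<Longrightarrow> (a z, b z) \<noteq> (0, 0) \<and> to_circle (a z) (b z) = z"
    for a b c :: "complex \<Rightarrow> real"
  proof -
    have "(\<lambda>z. inverse (Q (a z) (b z))) differentiable (at p)"
      using PQ[of "a p" "b p"] ab[of p] c(2) assms(2)
      by (intro differentiable_inverse hom_poly_differentiable[OF Q a b]) auto
    then have "(\<lambda>z. P (a z) (b z) /\<^sub>R Q (a z) (b z)) differentiable (at p)"
      by (intro differentiable_scaleR hom_poly_differentiable[OF P a b])
    then obtain D where "((\<lambda>z. P (a z) (b z) /\<^sub>R Q (a z) (b z)) has_derivative D) (at p)"
      unfolding differentiable_def by blast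
    then have D: "((\<lambda>z. P (a z) (b z) /\<^sub>R Q (a z) (b z)) has_derivative D) (at p within unit_circle)"
      by (rule has_derivative_at_withinI)
    have "(c \<longlongrightarrow> c p) (at p)" using c(1) by (simp add: continuous_within)
    then have "\<forall>\<^sub>F z in at p. c z \<noteq> 0" using c(2) by (rule tendsto_imp_eventually_ne)
    then obtain e where e: "e > 0" "\<And>z. dist z p < e \<Longrightarrow> c z \<noteq> 0"
      using c(2) unfolding eventually_at by (metis UNIV_I)
    have "(f has_derivative D) (at p within unit_circle)"
    proof (rule has_derivative_transform_within[OF D e(1) assms(2)])
      fix z assume "z \<in> unit_circle" "dist z p < e"
      then show "P (a z) (b z) /\<^sub>R Q (a z) (b z) = f z"
        using PQ[of "a z" "b z"] ab[of z] e(2) by auto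
    qed
    then show ?thesis by (rule differentiableI)
  qed
  have lin: "Re differentiable (at p)" "Im differentiable (at p)"
    by (auto intro: bounded_linear_imp_differentiable bounded_linear_Re bounded_linear_Im)
  have sq: "(Re z)\<^sup>2 + (Im z)\<^sup>2 = 1" if "z \<in> unit_circle" for z
    using that by (simp add: cmod_def)
  show ?thesis
  proof (cases "Re p = - 1")
    case False
    show ?thesis
    proof (rule main)
      show "(\<lambda>z. 1 + Re z) differentiable (at p)" "Im differentiable (at p)"
        by (intro differentiable_add differentiable_const lin)+
      show "continuous (at p) (\<lambda>z. 1 + Re z)"
        by (intro differentiable_imp_continuous_within differentiable_add differentiable_const lin)
      show "1 + Re p \<noteq> 0" using False by simp
      fix z assume z: "z \<in> unit_circle" "1 + Re z \<noteq> 0"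
      have "(1 + Re z)\<^sup>2 + (Im z)\<^sup>2 = 2 * (1 + Re z)" "(1 + Re z)\<^sup>2 - (Im z)\<^sup>2 = 2 * (1 + Re z) * Re z"
        using sq[OF z(1)] by (simp_all add: power2_eq_square algebra_simps)
      then show "(1 + Re z, Im z) \<noteq> (0, 0) \<and> to_circle (1 + Re z) (Im z) = z"
        using z(2) by (simp add: to_circle_def complex_eq_iff
            del: left_diff_distrib_numeral right_diff_distrib_numeral)
    qed
  next
    case True
    show ?thesis
    proof (rule main)
      show "Im differentiable (at p)" "(\<lambda>z. 1 - Re z) differentiable (at p)"
        by (intro differentiable_diff differentiable_const lin)+
      show "continuous (at p) (\<lambda>z. 1 - Re z)"
        by (intro differentiable_imp_continuous_within differentiable_diff differentiable_const lin)
      show "1 - Re p \<noteq> 0" using True by simp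
      fix z assume z: "z \<in> unit_circle" "1 - Re z \<noteq> 0"
      have "(Im z)\<^sup>2 + (1 - Re z)\<^sup>2 = 2 * (1 - Re z)" "(Im z)\<^sup>2 - (1 - Re z)\<^sup>2 = 2 * (1 - Re z) * Re z"
        using sq[OF z(1)] by (simp_all add: power2_eq_square algebra_simps)
      then show "(Im z, 1 - Re z) \<noteq> (0, 0) \<and> to_circle (Im z) (1 - Re z) = z"
        using z(2) by (simp add: to_circle_def complex_eq_iff
            del: left_diff_distrib_numeral right_diff_distrib_numeral)
    qed
  qed
qed

lemma bounded_rational_continuous_on:
  fixes f :: "complex \<Rightarrow> 'a::real_normed_vector"
  assumes "bounded_rational_on_circle f"
  shows "continuous_on unit_circle f"
  using bounded_rational_differentiable[OF assms]
  by (auto simp: continuous_on_eq_continuous_within intro: differentiable_imp_continuous_within)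

text \<open>Removing the common real zeros of numerator and denominator leaves a denominator \<open>Q1\<close> without
  zeros: by continuity the numerator is \<open>f\<close> times \<open>Q1\<close> everywhere, so a zero of \<open>Q1\<close> would be
  a common zero.\<close>

lemma continuous_rational_imp_bounded_rational:
  fixes f :: "complex \<Rightarrow> 'a::real_normed_vector"
  assumes rat: "rational_on_circle f" and cont: "continuous_on unit_circle f"
  shows "bounded_rational_on_circle f"
proof -
  obtain n P Q a b where P: "hom_poly n P" and Q: "hom_poly n Q" and ab: "Q a b \<noteq> (0::real)"
    and PQ: "\<And>u v. (u, v) \<noteq> (0, 0) \<Longrightarrow> Q u v \<noteq> 0 \<Longrightarrow> f (to_circle u v) = P u v /\<^sub>R Q u v"
    using rat unfolding rational_on_circle_def by blast
  obtain d m g and F :: "real \<Rightarrow> real \<Rightarrow> 'a \<times> real" where g: "hom_poly d g" and F: "hom_poly m F"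
    and eq: "\<And>u v. (P u v, Q u v) = (g u v :: real) *\<^sub>R F u v"
    and nz: "\<And>u v. (u, v) \<noteq> (0, 0) \<Longrightarrow> F u v \<noteq> 0"
    using hom_poly_remove_zeros[OF hom_poly_Pair[OF P Q], of a b] ab by (auto simp: zero_prod_def)
  define P1 Q1 where "P1 u v = fst (F u v)" and "Q1 u v = snd (F u v)" for u v
  have hP1: "hom_poly m P1" and hQ1: "hom_poly m Q1"
    unfolding P1_def[abs_def] Q1_def[abs_def] by (auto intro!: hom_poly_linear[OF _ F] simp: linear_iff)
  have gP: "P u v = g u v *\<^sub>R P1 u v" and gQ: "Q u v = g u v * Q1 u v" for u v
    using eq[of u v] by (simp_all add: P1_def Q1_def prod_eq_iff)
  have cf: "continuous_on (- {(0, 0)}) (\<lambda>z. f (to_circle (fst z) (snd z)))"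
    by (rule continuous_on_comp_to_circle[OF cont])
  have key: "Q1 u v *\<^sub>R f (to_circle u v) - P1 u v = 0" if "(u, v) \<noteq> (0, 0)" for u v
  proof (rule continuous_eq_0_off_hom_poly_zeros[OF Q ab _ _ that])
    show "continuous_on (- {(0, 0)}) (\<lambda>(u, v). Q1 u v *\<^sub>R f (to_circle u v) - P1 u v)"
      unfolding case_prod_unfold
      by (intro continuous_intros cf hom_poly_continuous_on[OF hP1] hom_poly_continuous_on[OF hQ1])
    fix u v :: real assume "(u, v) \<noteq> (0, 0)" "Q u v \<noteq> 0"
    then show "Q1 u v *\<^sub>R f (to_circle u v) - P1 u v = 0"
      using PQ[of u v] gP[of u v] gQ[of u v] by (simp add: field_simps)
  qed
  have "Q1 u v \<noteq> 0 \<and> f (to_circle u v) = P1 u v /\<^sub>R Q1 u v" if "(u, v) \<noteq> (0, 0)" for u v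
  proof -
    have "Q1 u v \<noteq> 0"
      using key[OF that] nz[OF that] by (auto simp: P1_def Q1_def prod_eq_iff zero_prod_def)
    moreover have "P1 u v = Q1 u v *\<^sub>R f (to_circle u v)" using key[OF that] by simp
    ultimately show ?thesis by simp
  qed
  then show ?thesis
    unfolding bounded_rational_on_circle_def using hP1 hQ1 by blast
qed

lemma bounded_rational_divide:
  fixes f :: "complex \<Rightarrow> 'a::real_vector" and g :: "complex \<Rightarrow> real"
  assumes "bounded_rational_on_circle f" "bounded_rational_on_circle g"
    and nz: "\<And>p. p \<in> unit_circle \<Longrightarrow> g p \<noteq> 0"
  shows "bounded_rational_on_circle (\<lambda>p. f p /\<^sub>R g p)"
proof -
  obtain m P Q where P: "hom_poly m P" and Q: "hom_poly m Q"
    and PQ: "\<And>u v. (u, v) \<noteq> (0, 0) \<Longrightarrow> Q u v \<noteq> (0::real) \<and> f (to_circle u v) = P u v /\<^sub>R Q u v"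
    using assms(1) unfolding bounded_rational_on_circle_def by blast
  obtain n X Y where X: "hom_poly n X" and Y: "hom_poly n Y"
    and XY: "\<And>u v. (u, v) \<noteq> (0, 0) \<Longrightarrow> Y u v \<noteq> (0::real) \<and> g (to_circle u v) = X u v /\<^sub>R Y u v"
    using assms(2) unfolding bounded_rational_on_circle_def by blast
  have "X u v *\<^sub>R Q u v \<noteq> 0 \<and>
      f (to_circle u v) /\<^sub>R g (to_circle u v) = (Y u v *\<^sub>R P u v) /\<^sub>R (X u v *\<^sub>R Q u v)"
    if "(u, v) \<noteq> (0, 0)" for u v
    using PQ[OF that] XY[OF that] nz[OF to_circle_in[OF that]] by (auto simp: field_simps)
  then show ?thesis
    unfolding bounded_rational_on_circle_def
    using hom_poly_mult[OF Y P] hom_poly_mult[OF X Q] by blast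
qed


section \<open>The velocity of a rational curve\<close>

lemma hom_poly_angular_derivative:
  fixes P :: "real \<Rightarrow> real \<Rightarrow> 'a::real_normed_vector"
  assumes "hom_poly n P"
  shows "\<exists>P'. hom_poly n P' \<and> (\<forall>u v. ((\<lambda>s. P (u * cos s - v * sin s) (v * cos s + u * sin s))
    has_vector_derivative P' u v) (at 0))"
  using assms
proof (induction rule: hom_poly_induct)
  case (const c)
  show ?case
    by (rule exI[of _ "\<lambda>u v. 0"]) (simp add: hom_poly_const)
next
  case (step n P c)
  then obtain P' where P': "hom_poly n P'"
    and der: "\<And>u v. ((\<lambda>s. P (u * cos s - v * sin s) (v * cos s + u * sin s))
      has_vector_derivative P' u v) (at 0)"
    by blast
  let ?D = "\<lambda>u v. (u *\<^sub>R P' u v + (- 1) *\<^sub>R (v *\<^sub>R P u v)) + u *\<^sub>R (v ^ n *\<^sub>R (real (Suc n) *\<^sub>R c))"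
  have "hom_poly (Suc n) ?D"
    by (intro hom_poly_add hom_poly_cmult hom_poly_times_u hom_poly_times_v hom_poly_monom P' step)
  moreover have "((\<lambda>s. (u * cos s - v * sin s) *\<^sub>R P (u * cos s - v * sin s) (v * cos s + u * sin s)
      + (v * cos s + u * sin s) ^ Suc n *\<^sub>R c) has_vector_derivative ?D u v) (at 0)" for u v
  proof -
    have a: "((\<lambda>s. u * cos s - v * sin s) has_real_derivative - v) (at 0)"
      by (auto intro!: derivative_eq_intros)
    have b: "((\<lambda>s. (v * cos s + u * sin s) ^ Suc n) has_real_derivative real (Suc n) * v ^ n * u) (at 0)"
      by (auto intro!: derivative_eq_intros simp del: power_Suc)
    show ?thesis
      by (rule has_vector_derivative_eq_rhs,
          rule has_vector_derivative_add[OF has_vector_derivative_scaleR[OF a der]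
            has_vector_derivative_scaleR[OF b has_vector_derivative_const]])
        (simp add: mult.commute mult.left_commute)
  qed
  ultimately show ?case by blast
qed

lemma has_vector_derivative_along_circle:
  fixes f :: "complex \<Rightarrow> 'a::real_normed_vector"
  assumes f: "f differentiable (at (p * cis (c * s)) within unit_circle)" and p: "p \<in> unit_circle"
  shows "((\<lambda>s. f (p * cis (c * s))) has_vector_derivative
    c *\<^sub>R circle_deriv f (p * cis (c * s)) (circle_tangent (p * cis (c * s)))) (at s)"
proof -
  let ?q = "p * cis (c * s)"
  have D: "(f has_derivative circle_deriv f ?q) (at ?q within unit_circle)"
    using f unfolding circle_deriv_def frechet_derivative_works .
  have g: "((\<lambda>s. p * cis (c * s)) has_derivative (\<lambda>h. h *\<^sub>R (c *\<^sub>R (\<i> * ?q)))) (at s)"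
    by (auto intro!: derivative_eq_intros simp: scaleR_conv_of_real)
  have sub: "range (\<lambda>s. p * cis (c * s)) \<subseteq> unit_circle"
    using p by (auto simp: norm_mult)
  have t: "circle_tangent ?q = \<i> * ?q"
    by (simp add: circle_tangent_def complex_eq_iff)
  have lin: "linear (circle_deriv f ?q)" using D by (rule has_derivative_linear)
  have "((\<lambda>s. f (p * cis (c * s))) has_derivative
      (\<lambda>h. circle_deriv f ?q (h *\<^sub>R (c *\<^sub>R (\<i> * ?q))))) (at s)"
    using diff_chain_within[OF g has_derivative_subset[OF D sub]] by (simp add: o_def)
  then show ?thesis
    unfolding has_vector_derivative_def t by (simp only: linear_scale[OF lin])
qed

text \<open>The derivation \<open>u * \<partial>\<^sub>v - v * \<partial>\<^sub>u\<close>, the derivative along rotations of \<open>(u, v)\<close>, preserves the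
  degree; by the quotient rule it turns \<open>P / Q\<close> into a quotient with denominator \<open>Q\<^sup>2\<close>. It is twice
  the derivative with respect to arc length, because \<open>to_circle\<close> doubles angles.\<close>

lemma bounded_rational_velocity:
  fixes f :: "complex \<Rightarrow> 'a::real_normed_vector"
  assumes f: "bounded_rational_on_circle f"
  shows "bounded_rational_on_circle (\<lambda>p. circle_deriv f p (circle_tangent p))"
proof -
  obtain n P Q where P: "hom_poly n P" and Q: "hom_poly n Q"
    and PQ: "\<And>u v. (u, v) \<noteq> (0, 0) \<Longrightarrow> Q u v \<noteq> (0::real) \<and> f (to_circle u v) = P u v /\<^sub>R Q u v"
    using f unfolding bounded_rational_on_circle_def by blast
  obtain P' where P': "hom_poly n P'"
    and derP: "\<And>u v. ((\<lambda>s. P (u * cos s - v * sin s) (v * cos s + u * sin s))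
      has_vector_derivative P' u v) (at 0)"
    using hom_poly_angular_derivative[OF P] by blast
  obtain Q' where Q': "hom_poly n Q'"
    and derQ: "\<And>u v. ((\<lambda>s. Q (u * cos s - v * sin s) (v * cos s + u * sin s))
      has_vector_derivative Q' u v) (at 0)"
    using hom_poly_angular_derivative[OF Q] by blast
  \<comment> \<open>The factor \<open>1 / 2\<close> compensates for the doubled angle.\<close>
  let ?N = "\<lambda>u v. (1 / 2) *\<^sub>R (Q u v *\<^sub>R P' u v - Q' u v *\<^sub>R P u v)"
  have N: "hom_poly (n + n) ?N"
    by (intro hom_poly_cmult hom_poly_diff hom_poly_mult P P' Q Q')
  have "Q u v *\<^sub>R Q u v \<noteq> 0 \<and>
      circle_deriv f (to_circle u v) (circle_tangent (to_circle u v)) = ?N u v /\<^sub>R (Q u v *\<^sub>R Q u v)"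
    if uv: "(u, v) \<noteq> (0, 0)" for u v
  proof -
    define a b where "a s = u * cos s - v * sin s" and "b s = v * cos s + u * sin s" for s
    let ?p = "to_circle u v"
    have q: "Q u v \<noteq> 0" using PQ[OF uv] by simp
    have p: "?p \<in> unit_circle" using uv by (rule to_circle_in)
    have ab: "(a s, b s) \<noteq> (0, 0)" for s
    proof
      assume "(a s, b s) = (0, 0)"
      moreover have "u = a s * cos s + b s * sin s" "v = b s * cos s - a s * sin s"
        using sin_cos_squared_add3[of s] unfolding a_def b_def by algebra+
      ultimately show False using uv by simp
    qed
    have 1: "((\<lambda>s. f (?p * cis (2 * s))) has_vector_derivative
        2 *\<^sub>R circle_deriv f ?p (circle_tangent ?p)) (at 0)"
      using has_vector_derivative_along_circle[of f ?p 2 0]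
        bounded_rational_differentiable[OF f p] p by simp
    have a0: "Q (a 0) (b 0) = Q u v" "P (a 0) (b 0) = P u v" by (simp_all add: a_def b_def)
    have "((\<lambda>s. Q (a s) (b s)) has_real_derivative Q' u v) (at 0)"
      using derQ by (simp add: a_def b_def has_real_derivative_iff_has_vector_derivative)
    then have "((\<lambda>s. inverse (Q (a s) (b s))) has_real_derivative
        - (inverse (Q u v) * Q' u v * inverse (Q u v))) (at 0)"
      using DERIV_inverse'[of "\<lambda>s. Q (a s) (b s)" "Q' u v" 0 UNIV] q by (simp add: a0)
    then have 2: "((\<lambda>s. P (a s) (b s) /\<^sub>R Q (a s) (b s)) has_vector_derivative
        inverse (Q u v) *\<^sub>R P' u v + (- (inverse (Q u v) * Q' u v * inverse (Q u v))) *\<^sub>R P u v) (at 0)"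
      using has_vector_derivative_scaleR[OF _ derP[of u v, folded a_def b_def]] by (fastforce simp: a0)
    have "P (a s) (b s) /\<^sub>R Q (a s) (b s) = f (?p * cis (2 * s))" for s
      using PQ[OF ab, of s] to_circle_rotate[of u s v] by (simp add: a_def b_def)
    with 2 have "((\<lambda>s. f (?p * cis (2 * s))) has_vector_derivative
        inverse (Q u v) *\<^sub>R P' u v + (- (inverse (Q u v) * Q' u v * inverse (Q u v))) *\<^sub>R P u v) (at 0)"
      by simp
    then have "2 *\<^sub>R circle_deriv f ?p (circle_tangent ?p) =
        inverse (Q u v) *\<^sub>R P' u v + (- (inverse (Q u v) * Q' u v * inverse (Q u v))) *\<^sub>R P u v"
      using 1 vector_derivative_unique_at by blast
    then have "(1 / 2) *\<^sub>R 2 *\<^sub>R circle_deriv f ?p (circle_tangent ?p) =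
        (1 / 2) *\<^sub>R (inverse (Q u v) *\<^sub>R P' u v
          + (- (inverse (Q u v) * Q' u v * inverse (Q u v))) *\<^sub>R P u v)"
      by (rule arg_cong)
    then show ?thesis
      using q by (simp add: scaleR_diff_right scaleR_add_right field_simps)
  qed
  then show ?thesis
    unfolding bounded_rational_on_circle_def using N hom_poly_mult[OF Q Q] by blast
qed

lemma circle_deriv_tangent_nonzero:
  fixes f :: "complex \<Rightarrow> 'a::real_normed_vector"
  assumes "f differentiable (at p within unit_circle)" "p \<in> unit_circle"
    and w: "w \<bullet> p = 0" "circle_deriv f p w \<noteq> 0"
  shows "circle_deriv f p (circle_tangent p) \<noteq> 0"
proof
  assume 0: "circle_deriv f p (circle_tangent p) = 0"
  have D: "(f has_derivative circle_deriv f p) (at p within unit_circle)"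
    using assms(1) unfolding circle_deriv_def frechet_derivative_works .
  have n: "Re p * Re p + Im p * Im p = 1" and o: "Re w * Re p + Im w * Im p = 0"
    using assms(2) w(1) by (simp_all add: cmod_def inner_complex_def power2_eq_square)
  have "w = (Im w * Re p - Re w * Im p) *\<^sub>R circle_tangent p"
    unfolding complex_eq_iff circle_tangent_def using n o by simp algebra
  then have "circle_deriv f p w = 0"
    using 0 linear_scale[OF has_derivative_linear[OF D]] by (metis scaleR_zero_right)
  then show False using w(2) by simp
qed

lemma arc_integral_velocity:
  fixes f :: "complex \<Rightarrow> 'a::banach"
  assumes f: "\<And>p. p \<in> unit_circle \<Longrightarrow> f differentiable (at p within unit_circle)"
    and "p \<in> unit_circle" "q \<in> unit_circle"
  shows "arc_integral p q (\<lambda>z. circle_deriv f z (circle_tangent z)) = f q - f p"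
proof -
  have der: "((\<lambda>s. f (p * cis s)) has_vector_derivative
      circle_deriv f (p * cis s) (circle_tangent (p * cis s))) (at s)" for s
    using has_vector_derivative_along_circle[of f p 1 s] f[of "p * cis s"] assms(2)
    by (simp add: norm_mult)
  have "((\<lambda>s. circle_deriv f (p * cis s) (circle_tangent (p * cis s))) has_integral
      f (p * cis (Arg2pi (q / p))) - f (p * cis 0)) {0..Arg2pi (q / p)}"
    by (rule fundamental_theorem_of_calculus[where f = "\<lambda>s. f (p * cis s)"])
      (use Arg2pi_ge_0 der has_vector_derivative_at_within in blast)+
  moreover have "cis (Arg2pi (q / p)) = q / p"
    using assms(2,3) complex_norm_eq_1_exp[of "q / p"] by (simp add: cis_conv_exp norm_divide)
  moreover have "p \<noteq> 0" using assms(2) by auto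
  ultimately show ?thesis
    unfolding arc_integral_def by (simp add: integral_unique)
qed


section \<open>Quaternion polynomials for rational unit vector fields\<close>

lemmas quat_simps = quat_eq_iff zero_quat_def plus_quat_def scaleR_quat_def one_quat_def
  times_quat_def quat_i_def quat_of_vec_def qcnj_def

lemma linear_quat_of_vec: "linear quat_of_vec"
  by (simp add: linear_iff quat_simps)

lemma norm_vec3_square: "(norm x)\<^sup>2 = (x $ 1)\<^sup>2 + (x $ 2)\<^sup>2 + (x $ 3)\<^sup>2" for x :: "real^3"
  unfolding power2_norm_eq_inner by (simp add: inner_vec_def sum_3 power2_eq_square)

text \<open>For \<open>A \<noteq> 0\<close> the equation in the assumption says that conjugation by \<open>A\<close> takes \<open>\<i>\<close> to
  \<open>t\<close>. It is linear in \<open>A\<close>, so it survives the removal of real zeros.\<close>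

lemma quat_conj_of_commute:
  assumes "A * quat_i = t * A" "A \<noteq> 0"
  shows "A * qcnj A \<noteq> 0" "t = (A * quat_i * qcnj A) / (A * qcnj A)"
proof -
  have "qcnj A \<noteq> 0" using assms(2) by (auto simp: quat_simps)
  then show nz: "A * qcnj A \<noteq> 0" using assms(2) by simp
  show "t = (A * quat_i * qcnj A) / (A * qcnj A)"
    by (simp only: assms(1) divide_quat_def mult.assoc[of t] right_inverse[OF nz] mult_1_right)
qed

text \<open>The half turn about \<open>t + \<i>\<close> exchanges the unit vectors \<open>\<i>\<close> and \<open>t\<close>, so \<open>t + \<i>\<close> is a
  solution \<open>A\<close> of the equation above, but it vanishes where \<open>t = - \<i>\<close>. After clearing
  the denominator of \<open>t\<close> these are the real zeros of a quaternion polynomial, which can be removed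
  unless it is zero; in that case \<open>t\<close> is constantly \<open>- \<i>\<close>, and \<open>\<j>\<close> is a solution.\<close>

lemma unit_field_quaternion_polynomial:
  fixes T :: "complex \<Rightarrow> real^3"
  assumes T: "bounded_rational_on_circle T"
    and unit: "\<And>p. p \<in> unit_circle \<Longrightarrow> norm (T p) = 1"
  shows "\<exists>n A. hom_poly n A \<and> (\<forall>u v. (u, v) \<noteq> (0, 0) \<longrightarrow>
    A u v \<noteq> 0 \<and> A u v * quat_i = quat_of_vec (T (to_circle u v)) * A u v)"
proof -
  obtain n X Y where X: "hom_poly n X" and Y: "hom_poly n Y"
    and XY: "\<And>u v. (u, v) \<noteq> (0, 0) \<Longrightarrow> Y u v \<noteq> (0::real) \<and> T (to_circle u v) = X u v /\<^sub>R Y u v"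
    using T unfolding bounded_rational_on_circle_def by blast
  define A0 where "A0 u v = quat_of_vec (X u v) + Y u v *\<^sub>R quat_i" for u v
  have hA0: "hom_poly n A0"
    unfolding A0_def[abs_def]
    by (intro hom_poly_add hom_poly_linear[OF linear_quat_of_vec X] hom_poly_linear[OF _ Y])
      (simp add: linear_iff scaleR_add_left)
  have A0: "A0 u v = Y u v *\<^sub>R (quat_of_vec (T (to_circle u v)) + quat_i)" if "(u, v) \<noteq> (0, 0)" for u v
    using XY[OF that] by (simp add: A0_def scaleR_add_right linear_scale[OF linear_quat_of_vec])
  have half_turn: "(quat_of_vec t + quat_i) * quat_i = quat_of_vec t * (quat_of_vec t + quat_i)"
    if "norm t = 1" for t
    using norm_vec3_square[of t] that
    by (simp add: quat_simps power2_eq_square algebra_simps)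
  show ?thesis
  proof (cases "\<exists>a b. A0 a b \<noteq> 0")
    case False
    have "quat_of_vec (T (to_circle u v)) = - quat_i" if "(u, v) \<noteq> (0, 0)" for u v
      using A0[OF that] False XY[OF that] by (simp add: eq_neg_iff_add_eq_0)
    moreover have "Quat 0 0 1 0 * quat_i = - quat_i * Quat 0 0 1 0" "Quat 0 0 1 0 \<noteq> 0"
      by (simp_all add: quat_simps uminus_quat_def)
    ultimately show ?thesis
      using hom_poly_const[of "Quat 0 0 1 0"] by (metis (no_types, lifting))
  next
    case True
    then obtain a b where ab: "A0 a b \<noteq> 0" by blast
    obtain d m g A where g: "hom_poly d g" and A: "hom_poly m A"
      and eq: "\<And>u v. A0 u v = (g u v :: real) *\<^sub>R A u v"
      and nz: "\<And>u v. (u, v) \<noteq> (0, 0) \<Longrightarrow> A u v \<noteq> 0"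
      using hom_poly_remove_zeros[OF hA0 ab] by blast
    have gab: "g a b \<noteq> 0" using ab eq by auto
    have off: "A u v * quat_i = quat_of_vec (T (to_circle u v)) * A u v"
      if uv: "(u, v) \<noteq> (0, 0)" and "g u v \<noteq> 0" for u v
    proof -
      have "A0 u v * quat_i = quat_of_vec (T (to_circle u v)) * A0 u v"
        unfolding A0[OF uv] using half_turn[OF unit[OF to_circle_in[OF uv]]] by simp
      then show ?thesis using that(2) by (simp add: eq)
    qed
    have cA: "continuous_on (- {(0, 0)}) (\<lambda>z. h (A (fst z) (snd z)))"
      if "linear h" for h :: "quat \<Rightarrow> real"
      by (rule hom_poly_continuous_on[OF hom_poly_linear[OF that A]]) (intro continuous_intros)+
    have lin: "linear qRe" "linear qI" "linear qJ" "linear qK"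
      by (simp_all add: linear_iff quat_simps)
    have cT: "continuous_on (- {(0, 0)}) (\<lambda>z. T (to_circle (fst z) (snd z)) $ i)" for i
      by (intro continuous_intros continuous_on_comp_to_circle bounded_rational_continuous_on T)
    have on: "A u v * quat_i = quat_of_vec (T (to_circle u v)) * A u v"
      if uv: "(u, v) \<noteq> (0, 0)" for u v
    proof -
      have "h (A u v * quat_i) - h (quat_of_vec (T (to_circle u v)) * A u v) = 0"
        if h: "h \<in> {qRe, qI, qJ, qK}" for h
      proof (rule continuous_eq_0_off_hom_poly_zeros[OF g gab _ _ uv])
        show "continuous_on (- {(0, 0)})
          (\<lambda>(u, v). h (A u v * quat_i) - h (quat_of_vec (T (to_circle u v)) * A u v))"
          using h unfolding case_prod_unfold
          by (auto simp: quat_simps intro!: continuous_intros cA[OF lin(1)] cA[OF lin(2)] cA[OF lin(3)] cA[OF lin(4)] cT)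
        fix u v :: real assume "(u, v) \<noteq> (0, 0)" "g u v \<noteq> 0"
        then show "h (A u v * quat_i) - h (quat_of_vec (T (to_circle u v)) * A u v) = 0"
          by (simp add: off)
      qed
      then show ?thesis by (simp add: quat_eq_iff)
    qed
    show ?thesis using A nz on by blast
  qed
qed


section \<open>Regular bounded rational PH curves\<close>

theorem theorem3p7:
  fixes R :: "complex \<Rightarrow> real^3"
  assumes "regular_bounded_rational_PH_curve R"
  shows "\<exists>(n::nat) (A :: real \<Rightarrow> real \<Rightarrow> quat) (L :: complex \<Rightarrow> real) (T :: complex \<Rightarrow> real^3).
    hom_poly n A \<and>
    bounded_rational_on_circle L \<and> (\<forall>p\<in>unit_circle. L p > 0) \<and>
    (\<forall>u v. (u, v) \<noteq> (0, 0) \<longrightarrow>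
      A u v * qcnj (A u v) \<noteq> 0 \<and>
      quat_of_vec (T (to_circle u v)) =
        (A u v * quat_i * qcnj (A u v)) / (A u v * qcnj (A u v))) \<and>
    (\<forall>p\<^sub>0\<in>unit_circle. \<forall>p\<^sub>1\<in>unit_circle.
      R p\<^sub>1 = R p\<^sub>0 + arc_integral p\<^sub>0 p\<^sub>1 (\<lambda>p. L p *\<^sub>R T p))"
proof -
  define V where "V p = circle_deriv R p (circle_tangent p)" for p
  define T where "T p = V p /\<^sub>R circle_speed R p" for p
  have R: "bounded_rational_on_circle R"
    and reg: "\<And>p. p \<in> unit_circle \<Longrightarrow> \<exists>w. w \<bullet> p = 0 \<and> circle_deriv R p w \<noteq> 0"
    and rat: "rational_on_circle (circle_speed R)"
    using assms
    unfolding regular_bounded_rational_PH_curve_def regular_bounded_rational_curve_def by blast+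
  have diff: "R differentiable (at p within unit_circle)" if "p \<in> unit_circle" for p
    using bounded_rational_differentiable[OF R that] .
  have speed: "circle_speed R p = norm (V p)" for p
    by (simp add: circle_speed_def V_def)
  have V: "bounded_rational_on_circle V"
    unfolding V_def[abs_def] by (rule bounded_rational_velocity[OF R])
  have Vnz: "V p \<noteq> 0" if "p \<in> unit_circle" for p
    using circle_deriv_tangent_nonzero[OF diff[OF that] that] reg[OF that] by (auto simp: V_def)
  have "continuous_on unit_circle (circle_speed R)"
    unfolding speed by (intro continuous_intros bounded_rational_continuous_on V)
  then have L: "bounded_rational_on_circle (circle_speed R)"
    by (rule continuous_rational_imp_bounded_rational[OF rat])
  have pos: "circle_speed R p > 0" if "p \<in> unit_circle" for p
    using Vnz[OF that] by (simp add: speed)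
  have T: "bounded_rational_on_circle T"
    unfolding T_def[abs_def] by (intro bounded_rational_divide V L) (use pos in fastforce)
  have "norm (T p) = 1" if "p \<in> unit_circle" for p
    using Vnz[OF that] by (simp add: T_def speed)
  then obtain n A where A: "hom_poly n A" "\<And>u v. (u, v) \<noteq> (0, 0) \<Longrightarrow>
      A u v \<noteq> 0 \<and> A u v * quat_i = quat_of_vec (T (to_circle u v)) * A u v"
    using unit_field_quaternion_polynomial[OF T] by blast
  have LT: "circle_speed R p *\<^sub>R T p = circle_deriv R p (circle_tangent p)" for p
    by (cases "V p = 0") (simp_all add: T_def speed V_def)
  have "R p\<^sub>1 = R p\<^sub>0 + arc_integral p\<^sub>0 p\<^sub>1 (\<lambda>p. circle_speed R p *\<^sub>R T p)"
    if "p\<^sub>0 \<in> unit_circle" "p\<^sub>1 \<in> unit_circle" for p\<^sub>0 p\<^sub>1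
  proof -
    have "arc_integral p\<^sub>0 p\<^sub>1 (\<lambda>p. circle_deriv R p (circle_tangent p)) = R p\<^sub>1 - R p\<^sub>0"
      by (intro arc_integral_velocity diff that)
    then show ?thesis unfolding LT by simp
  qed
  then show ?thesis
    using A L pos quat_conj_of_commute
    by (intro exI[of _ n] exI[of _ A] exI[of _ "circle_speed R"] exI[of _ T]) blast
qed

end
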